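(* Let $d\ge1$. The transformation $\mathcal{A}_{1}$ is not an Upsilon transformation $\Upsilon_{\tau}$ for any dilation measure $\tau$; that is, there is no measure $\tau$ on $(0,\infty)$ such that $\mathcal{A}_1=\Upsilon_\tau$ as transformations of measures on $\mathbb{R}^d$.
   Context: $\mathfrak{M}_L(\mathbb{R}^d)$ is the class of Lévy measures on $\mathbb{R}^d$: measures $\nu$ with $\nu(\{0\})=0$ and $\int_{\mathbb{R}^d}(1\wedge|x|^2)\,\nu(\mathrm{d}x)<\infty$. $\mathfrak{M}_L^1(\mathbb{R}^d)$ is the class of $\nu\in\mathfrak{M}_L(\mathbb{R}^d)$ with $\int_{\mathbb{R}^d}(1\wedge|x|)\,\nu(\mathrm{d}x)<\infty$. For $s>0$ let $a_1(r;s)=2\pi^{-1}(s-r^2)^{-1/2}1_{(0,s^{1/2})}(r)$. For a measure $\nu$ on $\mathbb{R}^d$ define $$\mathcal{A}_1(\nu)(B)=\int_{\mathbb{R}^d\setminus\{0\}}\nu(\mathrm{d}x)\int_0^\infty a_1(r;|x|)\,1_B\!\left(r\frac{x}{|x|}\right)\mathrm{d}r,\qquad B\in\mathcal{B}(\mathbb{R}^d);$$ its domain is the class of measures $\nu$ with $\nu(\{0\})=0$ for which the right-hand side is a measure in $\mathfrak{M}_L(\mathbb{R}^d)$ (this domain equals $\mathfrak{M}_L^1(\mathbb{R}^d)$). Given a measure $\tau$ on $(0,\infty)$, the Upsilon transformation $\Upsilon_\tau$ with dilation measure $\tau$ is $$\Upsilon_\tau(\nu)(B)=\int_0^\infty\nu(u^{-1}B)\,\tau(\mathrm{d}u),\qquad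 B\in\mathcal{B}(\mathbb{R}^d),$$ with domain the class of $\sigma$-finite measures $\nu$ on $\mathbb{R}^d$ such that the right-hand side is a measure in $\mathfrak{M}_L(\mathbb{R}^d)$. *)

theory Defs
  imports "HOL-Analysis.Analysis"
begin

definition levy_measure :: "'a::euclidean_space measure \<Rightarrow> bool" where
  "levy_measure \<nu> \<longleftrightarrow>
     sets \<nu> = sets borel \<and> emeasure \<nu> {0} = 0 \<and>
     (\<integral>\<^sup>+x. ennreal (min 1 ((norm x)\<^sup>2)) \<partial>\<nu>) < \<infinity>"

text \<open>A transformation is a partial map on measures, undefined (value None) off its
  domain, so that equality of transformations means equality of domains together with
  equality of values on the domain.  It is obtained here from a set function \<open>\<mu>\<close>, the
  right-hand side of its defining formula.  Countable additivity is checked explicitly,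
  because \<^const>\<open>measure_of\<close> silently returns the zero measure when it fails.\<close>

definition levy_of :: "('a::euclidean_space set \<Rightarrow> ennreal) \<Rightarrow> 'a measure option" where
  "levy_of \<mu> =
     (if measure_space UNIV (sets borel) \<mu> \<and> levy_measure (measure_of UNIV (sets borel) \<mu>)
      then Some (measure_of UNIV (sets borel) \<mu>) else None)"

definition a1 :: "real \<Rightarrow> real \<Rightarrow> real" where
  "a1 r s = 2 / pi * (s - r\<^sup>2) powr (- 1 / 2) * indicator {0<..<s powr (1 / 2)} r"

definition A1_rhs :: "'a::euclidean_space measure \<Rightarrow> 'a set \<Rightarrow> ennreal" where
  "A1_rhs \<nu> B =
     (\<integral>\<^sup>+x\<in>UNIV - {0}.
        (\<integral>\<^sup>+r\<in>{0<..}. ennreal (a1 r (norm x)) * indicator B (r *\<^sub>R (x /\<^sub>R norm x)) \<partial>lborel) \<partial>\<nu>)"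

definition A1 :: "'a::euclidean_space measure \<rightharpoonup> 'a measure" where
  "A1 \<nu> =
     (if sets \<nu> = sets borel \<and> emeasure \<nu> {0} = 0 then levy_of (A1_rhs \<nu>) else None)"

definition dilation_measure :: "real measure \<Rightarrow> bool" where
  "dilation_measure \<tau> \<longleftrightarrow> sets \<tau> = sets (restrict_space borel {0<..})"

definition Upsilon_rhs ::
    "real measure \<Rightarrow> 'a::euclidean_space measure \<Rightarrow> 'a set \<Rightarrow> ennreal" where
  "Upsilon_rhs \<tau> \<nu> B = (\<integral>\<^sup>+u. emeasure \<nu> ((\<lambda>x. inverse u *\<^sub>R x) ` B) \<partial>\<tau>)"

definition Upsilon ::
    "real measure \<Rightarrow> 'a::euclidean_space measure \<rightharpoonup> 'a measure" where
  "Upsilon \<tau> \<nu> =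
     (if sets \<nu> = sets borel \<and> sigma_finite_measure \<nu> then levy_of (Upsilon_rhs \<tau> \<nu>) else None)"

end

theory Submission imports Defs "HOL-Probability.Giry_Monad" begin

text \<open>
  An Upsilon transformation commutes with dilations: it sends the unit mass at \<open>v \<noteq> 0\<close> to the
  image of \<open>\<tau>\<close> under \<open>u \<mapsto> u v\<close>, so the value on \<open>{x. norm v \<le> norm x}\<close> is \<open>\<tau> [1, \<infinity>)\<close> for
  every \<open>v\<close> (lemma \<open>Upsilon_rhs_return_outside_ball\<close>). On the other hand \<open>A1\<close> sends the unit
  mass at \<open>v\<close> to the one-sided arcsine law on the segment from \<open>0\<close> to the point of norm
  \<open>sqrt (norm v)\<close> in the direction of \<open>v\<close> (lemma \<open>A1_return\<close>). Because the length of that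
  segment is the square root of \<open>norm v\<close>, the arcsine law has no mass outside the ball of radius
  \<open>norm v\<close> when \<open>norm v = 1\<close>, but has positive mass there when \<open>norm v = 1/4\<close>. So the two
  transformations already differ on unit masses, in every dimension.

  The analytic input is that the arcsine density is integrable up to its singularity; this puts
  the unit masses into the domain of \<open>A1\<close>, and hence into that of any \<open>Upsilon \<tau>\<close> equal to it.
\<close>

text \<open>
  For \<open>norm e = 1\<close> the mass lies on the segment of length \<open>sqrt s\<close>, not \<open>s\<close>: in \<open>a1 r s\<close> the
  parameter \<open>s\<close> is the square of the endpoint.
\<close>

definition arcsine_on_ray :: "real \<Rightarrow> 'a::euclidean_space \<Rightarrow> 'a measure" where
  "arcsine_on_ray s e = distr (density lborel (\<lambda>r. ennreal (a1 r s))) borel (\<lambda>r. r *\<^sub>R e)"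

lemma a1_measurable [measurable]:
  assumes [measurable]: "f \<in> borel_measurable M" "g \<in> borel_measurable M"
  shows "(\<lambda>x. a1 (f x) (g x)) \<in> borel_measurable M"
  unfolding a1_def indicator_def greaterThanLessThan_iff by measurable

lemma nn_integral_arcsine_on_ray:
  assumes [measurable]: "f \<in> borel_measurable borel"
  shows "(\<integral>\<^sup>+x. f x \<partial>arcsine_on_ray s e) = (\<integral>\<^sup>+r. ennreal (a1 r s) * f (r *\<^sub>R e) \<partial>lborel)"
  by (simp add: arcsine_on_ray_def nn_integral_distr nn_integral_density)

lemma emeasure_arcsine_on_ray:
  assumes [measurable]: "B \<in> sets borel"
  shows "emeasure (arcsine_on_ray s e) B =
    (\<integral>\<^sup>+r. ennreal (a1 r s) * indicator B (r *\<^sub>R e) \<partial>lborel)"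
  using nn_integral_arcsine_on_ray[of "indicator B" s e]
  by (simp add: arcsine_on_ray_def nn_integral_indicator)

text \<open>The antiderivative \<open>arcsin (r / sqrt s)\<close> is bounded, although the density is not.\<close>

lemma nn_integral_a1_finite:
  assumes s: "0 < s"
  shows "(\<integral>\<^sup>+r. ennreal (a1 r s) \<partial>lborel) < \<infinity>"
proof -
  define F where "F r = 2 / pi * arcsin (r / sqrt s)" for r
  define f where "f r = 2 / pi * (s - r\<^sup>2) powr (- 1 / 2)" for r
  have pos: "0 < s - r\<^sup>2" if "0 < r" "r < sqrt s" for r
  proof -
    have "r\<^sup>2 < (sqrt s)\<^sup>2" using that by (intro power_strict_mono) auto
    then show ?thesis using s by simp
  qed
  have int: "set_integrable lborel (einterval (ereal 0) (ereal (sqrt s))) f"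
  proof (rule interval_integral_FTC_nonneg(1)[where F = F and A = 0 and B = 1])
    show "ereal 0 < ereal (sqrt s)" using s by simp
    show "(F has_real_derivative f r) (at r)"
      if "ereal 0 < ereal r" "ereal r < ereal (sqrt s)" for r
    proof -
      have r: "0 < r" "r < sqrt s" using that by auto
      have "sqrt (1 - (r / sqrt s)\<^sup>2) = sqrt (s - r\<^sup>2) / sqrt s"
        using s by (simp add: power_divide diff_divide_distrib flip: real_sqrt_divide)
      moreover have "(s - r\<^sup>2) powr (- 1 / 2) = inverse (sqrt (s - r\<^sup>2))"
        using pos[OF r] by (simp add: powr_minus powr_half_sqrt)
      ultimately have "f r = 2 / pi * (inverse (sqrt (1 - (r / sqrt s)\<^sup>2)) * (1 / sqrt s))"
        using s by (simp add: f_def field_simps)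
      moreover have "((\<lambda>r. 2 / pi * arcsin (r / sqrt s)) has_real_derivative
          2 / pi * (inverse (sqrt (1 - (r / sqrt s)\<^sup>2)) * (1 / sqrt s))) (at r)"
      proof -
        have "-1 < r / sqrt s" using r s by (smt (verit) divide_pos_pos)
        then show ?thesis
          using r s by (intro DERIV_cmult DERIV_chain2[OF DERIV_arcsin] DERIV_cdivide DERIV_ident)
            (simp_all add: field_simps)
      qed
      ultimately show ?thesis by (simp add: F_def[abs_def])
    qed
    show "isCont f r" if "ereal 0 < ereal r" "ereal r < ereal (sqrt s)" for r
      unfolding f_def using pos[of r] that by (intro continuous_intros) auto
    show "AE r in lborel. ereal 0 < ereal r \<longrightarrow> ereal r < ereal (sqrt s) \<longrightarrow> 0 \<le> f r"
      by (simp add: f_def)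
    have cont: "continuous_on {0..sqrt s} F"
      unfolding F_def using s
      by (intro continuous_intros ballI) (auto simp: field_simps intro: order_trans[of _ 0])
    have lim0: "(F \<longlongrightarrow> 0) (at_right 0)"
      using continuous_on_Icc_at_rightD[OF cont] s by (simp add: F_def)
    have lim1: "(F \<longlongrightarrow> 1) (at_left (sqrt s))"
      using continuous_on_Icc_at_leftD[OF cont] s by (simp add: F_def)
    show "((F \<circ> real_of_ereal) \<longlongrightarrow> 0) (at_right (ereal 0))"
      using lim0 unfolding ereal_tendsto_simps by simp
    show "((F \<circ> real_of_ereal) \<longlongrightarrow> 1) (at_left (ereal (sqrt s)))"
      using lim1 unfolding ereal_tendsto_simps by simp
  qed
  have "integrable lborel (\<lambda>r. a1 r s)"
  proof -
    have "a1 r s = indicator (einterval (ereal 0) (ereal (sqrt s))) r *\<^sub>R f r" for r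
      using s by (auto simp: a1_def f_def powr_half_sqrt einterval_def indicator_def)
    then show ?thesis using int by (simp add: set_integrable_def)
  qed
  then show ?thesis
    by (simp add: integrable_iff_bounded a1_def top.not_eq_extremum)
qed

lemma levy_measure_arcsine_on_ray:
  assumes s: "0 < s" and e: "norm e = 1"
  shows "levy_measure (arcsine_on_ray s e)"
  unfolding levy_measure_def
proof (intro conjI)
  show "sets (arcsine_on_ray s e) = sets borel" by (simp add: arcsine_on_ray_def)
  have "(\<lambda>r. ennreal (a1 r s) * indicator {0} (r *\<^sub>R e)) = (\<lambda>_. 0)"
  proof -
    have "e \<noteq> 0" using e by auto
    then show ?thesis by (auto simp: fun_eq_iff a1_def indicator_def)
  qed
  then show "emeasure (arcsine_on_ray s e) {0} = 0"
    by (simp add: emeasure_arcsine_on_ray)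
  have "(\<integral>\<^sup>+x. ennreal (min 1 ((norm x)\<^sup>2)) \<partial>arcsine_on_ray s e) \<le>
      (\<integral>\<^sup>+x. 1 \<partial>arcsine_on_ray s e)"
    by (intro nn_integral_mono) simp
  also have "\<dots> = (\<integral>\<^sup>+r. ennreal (a1 r s) \<partial>lborel)"
    by (subst nn_integral_arcsine_on_ray) auto
  also have "\<dots> < \<infinity>" by (rule nn_integral_a1_finite[OF s])
  finally show "(\<integral>\<^sup>+x. ennreal (min 1 ((norm x)\<^sup>2)) \<partial>arcsine_on_ray s e) < \<infinity>" .
qed

lemma levy_of_emeasure:
  fixes N :: "'a::euclidean_space measure"
  assumes N: "levy_measure N" and eq: "\<And>B. B \<in> sets borel \<Longrightarrow> \<mu> B = emeasure N B"
  shows "levy_of \<mu> = Some N"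
proof -
  have sets_N: "sets N = sets borel" using N by (simp add: levy_measure_def)
  then have space_N: "space N = UNIV" using sets_eq_imp_space_eq[OF sets_N] by simp
  have sigma_sets_borel: "sigma_sets UNIV (sets borel) = sets (borel :: 'a measure)"
    using sets.sigma_sets_eq[of "borel :: 'a measure"] by simp
  have "measure_space UNIV (sets borel) (emeasure N) = measure_space UNIV (sets borel) \<mu>"
    using measure_space_eq[of "sets borel" UNIV "emeasure N" \<mu>] eq sigma_sets_borel by simp
  moreover have "measure_space UNIV (sets borel) (emeasure N)"
    using measure_space[of N] sets_N space_N by simp
  moreover have "measure_of UNIV (sets borel) \<mu> = measure_of UNIV (sets borel) (emeasure N)"
    using measure_of_eq[of "sets borel" UNIV \<mu> "emeasure N"] eq sigma_sets_borel by simp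
  moreover have "measure_of UNIV (sets borel) (emeasure N) = N"
    using measure_of_of_measure[of N] sets_N space_N by simp
  ultimately show ?thesis using N by (simp add: levy_of_def)
qed

lemma emeasure_of_levy_of:
  fixes \<mu> :: "'a::euclidean_space set \<Rightarrow> ennreal"
  assumes "levy_of \<mu> = Some N" and B: "B \<in> sets borel"
  shows "emeasure N B = \<mu> B"
proof -
  have m: "measure_space UNIV (sets borel) \<mu>" and N: "N = measure_of UNIV (sets borel) \<mu>"
    using assms(1) by (auto simp: levy_of_def split: if_splits)
  show ?thesis
    unfolding N
  proof (rule emeasure_measure_of_sigma)
    show "sigma_algebra UNIV (sets borel :: 'a set set)"
      "positive (sets borel) \<mu>" "countably_additive (sets borel) \<mu>"
      using m by (auto simp: measure_space_def)
  qed (rule B)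
qed

lemma A1_return:
  fixes e :: "'a::euclidean_space"
  assumes s: "0 < s" and e: "norm e = 1"
  shows "A1 (return borel (s *\<^sub>R e)) = Some (arcsine_on_ray s e)"
proof -
  have e0: "e \<noteq> 0" using e by auto
  have "A1_rhs (return borel (s *\<^sub>R e)) B = emeasure (arcsine_on_ray s e) B"
    if B[measurable]: "B \<in> sets borel" for B
  proof -
    have [measurable]: "(\<lambda>x::'a. (\<integral>\<^sup>+r\<in>{0<..}. ennreal (a1 r (norm x)) *
        indicator B (r *\<^sub>R (x /\<^sub>R norm x)) \<partial>lborel)) \<in> borel_measurable borel"
      by measurable
    have "A1_rhs (return borel (s *\<^sub>R e)) B =
        (\<integral>\<^sup>+r\<in>{0<..}. ennreal (a1 r s) * indicator B (r *\<^sub>R e) \<partial>lborel)"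
      unfolding A1_rhs_def using s e e0 by (subst nn_integral_return) simp_all
    also have "\<dots> = (\<integral>\<^sup>+r. ennreal (a1 r s) * indicator B (r *\<^sub>R e) \<partial>lborel)"
      by (intro nn_integral_cong) (auto simp: a1_def indicator_def)
    also have "\<dots> = emeasure (arcsine_on_ray s e) B"
      using B by (simp add: emeasure_arcsine_on_ray)
    finally show ?thesis .
  qed
  then have "levy_of (A1_rhs (return borel (s *\<^sub>R e))) = Some (arcsine_on_ray s e)"
    by (intro levy_of_emeasure levy_measure_arcsine_on_ray s e)
  moreover have "emeasure (return borel (s *\<^sub>R e)) {0} = 0"
    using s e0 by (simp add: indicator_def)
  ultimately show ?thesis by (simp add: A1_def)
qed

text \<open>
  Since \<open>u v\<close> is outside the open ball of radius \<open>norm v\<close> exactly when \<open>u \<ge> 1\<close>, the length of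
  \<open>v\<close> cancels. This is the scaling property that \<open>A1\<close> violates.
\<close>

lemma Upsilon_rhs_return_outside_ball:
  fixes v :: "'a::euclidean_space"
  assumes \<tau>: "dilation_measure \<tau>" and v: "v \<noteq> 0"
  shows "Upsilon_rhs \<tau> (return borel v) {x. norm v \<le> norm x} = emeasure \<tau> {1..}"
proof -
  have space: "space \<tau> = {0<..}"
    using sets_eq_imp_space_eq[OF \<tau>[unfolded dilation_measure_def]]
    by (simp add: space_restrict_space)
  have "{1..} \<in> sets \<tau>"
    using \<tau> by (auto simp: dilation_measure_def sets_restrict_space image_iff
        intro!: exI[of _ "{1..}"] bexI[of _ "{1..}"])
  moreover have "emeasure (return borel v) ((\<lambda>x. inverse u *\<^sub>R x) ` {x. norm v \<le> norm x}) =
      indicator {1..} u" if "u \<in> space \<tau>" for u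
  proof -
    have u: "0 < u" using that space by simp
    have "(\<lambda>x. inverse u *\<^sub>R x) ` {x. norm v \<le> norm x} \<in> sets borel"
      by (intro borel_closed closed_scaling closed_Collect_le continuous_intros)
    moreover have "v \<in> (\<lambda>x. inverse u *\<^sub>R x) ` {x. norm v \<le> norm x} \<longleftrightarrow> 1 \<le> u"
    proof
      assume "v \<in> (\<lambda>x. inverse u *\<^sub>R x) ` {x. norm v \<le> norm x}"
      then obtain x where x: "v = inverse u *\<^sub>R x" "norm v \<le> norm x" by blast
      have "norm x = u * norm v" using x(1) u by simp
      then show "1 \<le> u" using x(2) v by simp
    next
      assume "1 \<le> u"
      then have "norm v \<le> norm (u *\<^sub>R v)" using v by simp
      moreover have "v = inverse u *\<^sub>R (u *\<^sub>R v)" using u by simp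
      ultimately show "v \<in> (\<lambda>x. inverse u *\<^sub>R x) ` {x. norm v \<le> norm x}" by blast
    qed
    ultimately show ?thesis
      by (subst emeasure_return) (simp_all add: indicator_def)
  qed
  ultimately show ?thesis
    unfolding Upsilon_rhs_def by (simp cong: nn_integral_cong)
qed

lemma arcsine_on_ray_outside_ball:
  fixes e :: "'a::euclidean_space"
  assumes "norm e = 1" "0 < c"
  shows "emeasure (arcsine_on_ray s e) {x. c \<le> norm x} =
    (\<integral>\<^sup>+r. ennreal (a1 r s) * indicator {c..} r \<partial>lborel)"
proof -
  have "closed {x::'a. c \<le> norm x}" by (intro closed_Collect_le continuous_intros)
  then have "emeasure (arcsine_on_ray s e) {x. c \<le> norm x} =
      (\<integral>\<^sup>+r. ennreal (a1 r s) * indicator {x. c \<le> norm x} (r *\<^sub>R e) \<partial>lborel)"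
    by (intro emeasure_arcsine_on_ray borel_closed)
  also have "\<dots> = (\<integral>\<^sup>+r. ennreal (a1 r s) * indicator {c..} r \<partial>lborel)"
    using assms by (intro nn_integral_cong) (auto simp: a1_def indicator_def)
  finally show ?thesis .
qed

lemma arcsine_on_ray_outside_ball_eq_0:
  assumes "norm e = 1"
  shows "emeasure (arcsine_on_ray 1 e) {x. 1 \<le> norm x} = 0"
proof -
  have "(\<lambda>r. ennreal (a1 r 1) * indicator {1..} r) = (\<lambda>_. 0)"
    by (auto simp: a1_def indicator_def)
  then show ?thesis using arcsine_on_ray_outside_ball[OF assms, of 1 1] by simp
qed

text \<open>
  The segment has length \<open>sqrt (1/4) = 1/2\<close>, so it sticks out of the ball of radius \<open>1/4\<close>; on the
  part \<open>(1/4, 1/2)\<close> outside, the density is at least \<open>2 / pi\<close> because \<open>1/4 - r\<^sup>2 \<le> 1\<close>.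
\<close>

lemma arcsine_on_ray_outside_ball_pos:
  assumes "norm e = 1"
  shows "0 < emeasure (arcsine_on_ray (1/4) e) {x. 1/4 \<le> norm x}"
proof -
  have root: "(1/4) powr (1/2) = (1/2::real)"
    by (simp add: powr_half_sqrt real_sqrt_divide)
  have bound: "2 / pi \<le> a1 r (1/4)" if r: "r \<in> {1/4<..<1/2}" for r
  proof -
    have "r\<^sup>2 < (1/2)\<^sup>2" using r by (intro power_strict_mono) auto
    then have "0 < 1/4 - r\<^sup>2" "1/4 - r\<^sup>2 \<le> 1"
      by (auto simp: power2_eq_square intro: order_trans[of _ "1/4"])
    then have "1 \<le> (1/4 - r\<^sup>2) powr (- 1 / 2)"
      using powr_mono2'[of "-1/2" "1/4 - r\<^sup>2" 1] by simp
    then show ?thesis using r root by (simp add: a1_def divide_right_mono)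
  qed
  have "0 < ennreal (2 / pi) * ennreal (1/4)"
    by (simp add: ennreal_zero_less_mult_iff)
  also have "\<dots> = (\<integral>\<^sup>+r. ennreal (2 / pi) * indicator {1/4<..<1/2::real} r \<partial>lborel)"
    by (subst nn_integral_cmult_indicator) auto
  also have "\<dots> \<le> (\<integral>\<^sup>+r. ennreal (a1 r (1/4)) * indicator {1/4..} r \<partial>lborel)"
    using bound by (intro nn_integral_mono) (auto simp: indicator_def intro!: ennreal_leI)
  also have "\<dots> = emeasure (arcsine_on_ray (1/4) e) {x. 1/4 \<le> norm x}"
    using arcsine_on_ray_outside_ball[OF assms, of "1/4" "1/4"] by simp
  finally show ?thesis .
qed

theorem theorem3p16:
  "\<not> (\<exists>\<tau> :: real measure. dilation_measure \<tau> \<and>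
        (A1 :: (real ^ 'd::finite) measure \<rightharpoonup> (real ^ 'd) measure) = Upsilon \<tau>)"
proof
  assume "\<exists>\<tau> :: real measure. dilation_measure \<tau> \<and>
    (A1 :: (real ^ 'd::finite) measure \<rightharpoonup> (real ^ 'd) measure) = Upsilon \<tau>"
  then obtain \<tau> where \<tau>: "dilation_measure \<tau>"
    and eq: "(A1 :: (real ^ 'd) measure \<rightharpoonup> (real ^ 'd) measure) = Upsilon \<tau>" by blast
  obtain e :: "real ^ 'd" where "e \<in> Basis" using nonempty_Basis by blast
  then have e: "norm e = 1" by simp
  have mass: "emeasure (arcsine_on_ray s e) {x. s \<le> norm x} = emeasure \<tau> {1..}" if s: "0 < s" for s
  proof -
    have "Upsilon \<tau> (return borel (s *\<^sub>R e)) = Some (arcsine_on_ray s e)"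
      using A1_return[OF s e] eq by simp
    then have "levy_of (Upsilon_rhs \<tau> (return borel (s *\<^sub>R e))) = Some (arcsine_on_ray s e)"
      by (simp add: Upsilon_def split: if_splits)
    moreover have "closed {x :: real ^ 'd. s \<le> norm x}"
      by (intro closed_Collect_le continuous_intros)
    ultimately have "emeasure (arcsine_on_ray s e) {x. s \<le> norm x} =
        Upsilon_rhs \<tau> (return borel (s *\<^sub>R e)) {x. s \<le> norm x}"
      by (intro emeasure_of_levy_of borel_closed)
    moreover have "s *\<^sub>R e \<noteq> 0" using s e by auto
    ultimately show ?thesis
      using Upsilon_rhs_return_outside_ball[OF \<tau>, of "s *\<^sub>R e"] s e by simp
  qed
  have "emeasure \<tau> {1..} = 0"
    using mass[of 1] arcsine_on_ray_outside_ball_eq_0[OF e] by simp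
  then show False
    using mass[of "1/4"] arcsine_on_ray_outside_ball_pos[OF e] by simp
qed

end
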